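(* Let $r\ge 2$, let $X$ be a fibrewise space over $B$, and let $pr_i\colon X_B^r\to X$ be the projection onto the $i$-th factor of the $r$-fold fibred product $X_B^r$ of $X$ over $B$. Then $$D_B(pr_1,\dots,pr_r)=\mathrm{secat}_B\bigl(\Pi_{r,X}\colon P_B(X)\to X_B^r\bigr)=\mathrm{TC}_{B,r}(X).$$
   Context: All spaces are topological spaces, all maps are continuous, $I=[0,1]$. A fibrewise space over $B$ is a space $X$ with a map $p_X\colon X\to B$; a fibrewise map $f\colon X\to Y$ satisfies $p_Y\circ f=p_X$. Subspaces are fibrewise by restriction. $f\simeq_B g$ means there is $H\colon X\times I\to Y$ with $p_Y(H(x,t))=p_X(x)$, $H(\cdot,0)=f$, $H(\cdot,1)=g$. For fibrewise maps $f_1,\dots,f_r\colon X\to Y$, $D_B(f_1,\dots,f_r)$ is the least $n\ge 0$ (or $\infty$) such that $X$ has an open cover $\{U_0,\dots,U_n\}$ with $f_s|_{U_i}\simeq_B f_t|_{U_i}$ for all $0\le i\le n$, $1\le s,t\le r$. For a fibrewise map $f\colon E\to X$, $\mathrm{secat}_B(f)$ is the least $k\ge 0$ (or $\infty$) such that $X$ has an open cover $\{U_0,\dots,U_k\}$ where for each $i$ there is a fibrewise map $s_i\colon U_i\to E$ with $f\circ s_i\simeq_B i_{U_i}$ (inclusion). $P_B(X)=\{(b,\alpha)\in B\times X^I\mid p_X\circ\alpha \text{ is constant at } b\}$ (compact-open topology on $X^I$), projection $(b,\alpha)\mapsto b$; $\Pi_{r,X}(b,\gamma)=(\gamma(0),\gamma(\tfrac1{r-1}),\dots,\gamma(1))$;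 and by definition $\mathrm{TC}_{B,r}(X):=\mathrm{secat}_B(\Pi_{r,X})$. *)

theory Defs
  imports "HOL-Analysis.Analysis" "HOL-Library.Extended_Nat"
begin

text \<open>
  A fibrewise space over \<open>B\<close> is carried as a topology \<open>X\<close> together with its projection \<open>p\<close>.  Only
  values on \<open>topspace X\<close> matter.  A subspace \<open>U\<close> is \<open>subtopology X U\<close> with the same \<open>p\<close>.
\<close>

definition fibrewise_space :: "'b topology \<Rightarrow> 'a topology \<Rightarrow> ('a \<Rightarrow> 'b) \<Rightarrow> bool" where
  "fibrewise_space B X p \<longleftrightarrow> continuous_map X B p"

definition fibrewise_map ::
  "'a topology \<Rightarrow> ('a \<Rightarrow> 'b) \<Rightarrow> 'c topology \<Rightarrow> ('c \<Rightarrow> 'b) \<Rightarrow> ('a \<Rightarrow> 'c) \<Rightarrow> bool" where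
  "fibrewise_map X p Y q f \<longleftrightarrow> continuous_map X Y f \<and> (\<forall>x\<in>topspace X. q (f x) = p x)"

text \<open>
  The side condition of \<open>homotopic_with\<close> is imposed at every stage \<open>t\<close> of the homotopy \<open>H\<close>, so it
  says that \<open>q (H (t, x)) = p x\<close> for all \<open>t\<close> in \<open>[0,1]\<close> and all \<open>x\<close>.
\<close>

definition fibrewise_homotopic ::
  "'a topology \<Rightarrow> ('a \<Rightarrow> 'b) \<Rightarrow> 'c topology \<Rightarrow> ('c \<Rightarrow> 'b) \<Rightarrow> ('a \<Rightarrow> 'c) \<Rightarrow> ('a \<Rightarrow> 'c) \<Rightarrow> bool" where
  "fibrewise_homotopic X p Y q f g \<longleftrightarrow>
     homotopic_with (\<lambda>h. \<forall>x\<in>topspace X. q (h x) = p x) X Y f g"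

definition open_cover_upto :: "'a topology \<Rightarrow> nat \<Rightarrow> (nat \<Rightarrow> 'a set) \<Rightarrow> bool" where
  "open_cover_upto X n U \<longleftrightarrow> (\<forall>i\<le>n. openin X (U i)) \<and> (\<Union>i\<le>n. U i) = topspace X"

text \<open>
  In \<open>enat\<close> the infimum of a nonempty set is its least element, and the infimum of the empty set
  is \<open>\<infinity>\<close>.
\<close>

definition fibrewise_dist ::
  "'a topology \<Rightarrow> ('a \<Rightarrow> 'b) \<Rightarrow> 'c topology \<Rightarrow> ('c \<Rightarrow> 'b) \<Rightarrow> nat \<Rightarrow> (nat \<Rightarrow> 'a \<Rightarrow> 'c) \<Rightarrow> enat" where
  "fibrewise_dist X p Y q r f =
     Inf {enat n | n. \<exists>U. open_cover_upto X n U \<and>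
       (\<forall>i\<le>n. \<forall>s\<in>{1..r}. \<forall>t\<in>{1..r}.
          fibrewise_homotopic (subtopology X (U i)) p Y q (f s) (f t))}"

definition fibrewise_secat ::
  "'e topology \<Rightarrow> ('e \<Rightarrow> 'b) \<Rightarrow> 'a topology \<Rightarrow> ('a \<Rightarrow> 'b) \<Rightarrow> ('e \<Rightarrow> 'a) \<Rightarrow> enat" where
  "fibrewise_secat E e X p f =
     Inf {enat k | k. \<exists>U. open_cover_upto X k U \<and>
       (\<forall>i\<le>k. \<exists>s. fibrewise_map (subtopology X (U i)) p E e s \<and>
          fibrewise_homotopic (subtopology X (U i)) p X p (f \<circ> s) (\<lambda>x. x))}"

text \<open>
  Points of the mapping space are taken extensional, i.e. \<open>undefined\<close> outside \<open>topspace Z\<close>, so that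
  each continuous map is represented exactly once.
\<close>

definition compact_open_topology :: "'z topology \<Rightarrow> 'a topology \<Rightarrow> ('z \<Rightarrow> 'a) topology" where
  "compact_open_topology Z X = topology_generated_by
     {{f \<in> extensional (topspace Z). continuous_map Z X f \<and> f ` K \<subseteq> U} | K U.
        compactin Z K \<and> openin X U}"

lemma topspace_compact_open_topology:
  "topspace (compact_open_topology Z X) = {f \<in> extensional (topspace Z). continuous_map Z X f}"
proof -
  let ?W = "\<lambda>K U. {f \<in> extensional (topspace Z). continuous_map Z X f \<and> f ` K \<subseteq> U}"
  have "\<Union>{?W K U | K U. compactin Z K \<and> openin X U} = ?W {} {}"
  proof
    show "?W {} {} \<subseteq> \<Union>{?W K U | K U. compactin Z K \<and> openin X U}"
      by (rule Union_upper) (use compactin_empty openin_empty in blast)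
  qed auto
  then show ?thesis
    by (simp add: compact_open_topology_def)
qed

abbreviation path_space :: "'a topology \<Rightarrow> (real \<Rightarrow> 'a) topology" where
  "path_space X \<equiv> compact_open_topology (top_of_set {0..1}) X"

text \<open>The projection of \<open>fibrewise_path_space B X p\<close> to \<open>B\<close> is \<open>fst\<close>.\<close>

definition fibrewise_path_space ::
  "'b topology \<Rightarrow> 'a topology \<Rightarrow> ('a \<Rightarrow> 'b) \<Rightarrow> ('b \<times> (real \<Rightarrow> 'a)) topology" where
  "fibrewise_path_space B X p =
     subtopology (prod_topology B (path_space X)) {(b, \<alpha>). \<forall>t\<in>{0..1}. p (\<alpha> t) = b}"

text \<open>
  Points of the \<open>r\<close>-fold fibred product are families \<open>(x 1, \<dots>, x r)\<close>, as in \<open>product_topology\<close>.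
  For \<open>r \<ge> 1\<close> the common value \<open>p (x 1) = \<dots> = p (x r)\<close> is the projection to \<open>B\<close>.
\<close>

definition fibre_power :: "'a topology \<Rightarrow> ('a \<Rightarrow> 'b) \<Rightarrow> nat \<Rightarrow> (nat \<Rightarrow> 'a) topology" where
  "fibre_power X p r =
     subtopology (product_topology (\<lambda>_. X) {1..r}) {x. \<forall>i\<in>{1..r}. \<forall>j\<in>{1..r}. p (x i) = p (x j)}"

definition fibre_power_proj :: "('a \<Rightarrow> 'b) \<Rightarrow> (nat \<Rightarrow> 'a) \<Rightarrow> 'b" where
  "fibre_power_proj p x = p (x 1)"

definition pr :: "nat \<Rightarrow> (nat \<Rightarrow> 'a) \<Rightarrow> 'a" where
  "pr i x = x i"

definition path_eval :: "nat \<Rightarrow> 'b \<times> (real \<Rightarrow> 'a) \<Rightarrow> nat \<Rightarrow> 'a" where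
  "path_eval r = (\<lambda>(b, \<gamma>). \<lambda>i\<in>{1..r}. \<gamma> ((real i - 1) / (real r - 1)))"

definition fibrewise_TC :: "'b topology \<Rightarrow> 'a topology \<Rightarrow> ('a \<Rightarrow> 'b) \<Rightarrow> nat \<Rightarrow> enat" where
  "fibrewise_TC B X p r =
     fibrewise_secat (fibrewise_path_space B X p) fst
       (fibre_power X p r) (fibre_power_proj p) (path_eval r)"

lemma fibrewise_map_pr:
  assumes "i \<in> {1..r}"
  shows "fibrewise_map (fibre_power X p r) (fibre_power_proj p) X p (pr i)"
proof -
  have "continuous_map (fibre_power X p r) X (pr i)"
    unfolding fibre_power_def pr_def
    by (intro continuous_map_from_subtopology continuous_map_product_projection assms)
  moreover have "p (pr i x) = fibre_power_proj p x" if "x \<in> topspace (fibre_power X p r)" for x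
  proof -
    have "\<forall>i\<in>{1..r}. \<forall>j\<in>{1..r}. p (x i) = p (x j)"
      using that unfolding fibre_power_def topspace_subtopology by blast
    moreover have "1 \<in> {1..r}"
      using assms by simp
    ultimately show ?thesis
      using assms unfolding fibre_power_proj_def pr_def by blast
  qed
  ultimately show ?thesis
    unfolding fibrewise_map_def by blast
qed

lemma continuous_map_compact_open_eval:
  assumes "t \<in> topspace Z"
  shows "continuous_map (compact_open_topology Z X) X (\<lambda>f. f t)"
proof -
  have "openin (compact_open_topology Z X)
          {f \<in> topspace (compact_open_topology Z X). f t \<in> U}" if "openin X U" for U
  proof -
    let ?W = "{f \<in> extensional (topspace Z). continuous_map Z X f \<and> f ` {t} \<subseteq> U}"
    have "compactin Z {t}"
      using assms by simp
    then have "openin (compact_open_topology Z X) ?W"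
      using that unfolding compact_open_topology_def
      by (intro topology_generated_by_Basis) blast
    moreover have "{f \<in> topspace (compact_open_topology Z X). f t \<in> U} = ?W"
      by (auto simp: topspace_compact_open_topology)
    ultimately show ?thesis
      by simp
  qed
  moreover have "f t \<in> topspace X" if "f \<in> topspace (compact_open_topology Z X)" for f
    using that assms by (auto simp: topspace_compact_open_topology continuous_map_def)
  ultimately show ?thesis
    by (auto simp: continuous_map_def)
qed

lemma fibrewise_map_path_eval:
  fixes B :: "'b topology" and X :: "'a topology" and p :: "'a \<Rightarrow> 'b"
  assumes "r \<ge> 2"
  shows "fibrewise_map (fibrewise_path_space B X p) fst
           (fibre_power X p r) (fibre_power_proj p) (path_eval r)"
proof -
  let ?P = "fibrewise_path_space B X p"
  define \<tau> where "\<tau> i = (real i - 1) / (real r - 1)" for i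
  have \<tau>: "\<tau> i \<in> {0..1}" if "i \<in> {1..r}" for i
    using that assms by (auto simp: \<tau>_def divide_simps)
  have eval: "path_eval r = (\<lambda>z::'b \<times> (real \<Rightarrow> 'a). \<lambda>i\<in>{1..r}. snd z (\<tau> i))"
    by (simp add: path_eval_def \<tau>_def fun_eq_iff)
  have fib: "p (snd z (\<tau> i)) = fst z" if "z \<in> topspace ?P" "i \<in> {1..r}" for z i
    using that(1) \<tau>[OF that(2)] by (auto simp: fibrewise_path_space_def)
  have "continuous_map ?P X (\<lambda>z. snd z (\<tau> i))" if "i \<in> {1..r}" for i
  proof -
    have "\<tau> i \<in> topspace (top_of_set {0..1})"
      using \<tau>[OF that] by simp
    from continuous_map_compose[OF continuous_map_snd continuous_map_compact_open_eval[OF this]]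
    show ?thesis
      unfolding fibrewise_path_space_def o_def by (rule continuous_map_from_subtopology)
  qed
  then have "continuous_map ?P (product_topology (\<lambda>_. X) {1..r}) (path_eval r)"
    unfolding continuous_map_componentwise eval by auto
  moreover have "path_eval r \<in> topspace ?P \<rightarrow> {x. \<forall>i\<in>{1..r}. \<forall>j\<in>{1..r}. p (x i) = p (x j)}"
  proof
    fix z assume "z \<in> topspace ?P"
    then show "path_eval r z \<in> {x. \<forall>i\<in>{1..r}. \<forall>j\<in>{1..r}. p (x i) = p (x j)}"
      using fib by (simp add: eval)
  qed
  ultimately have "continuous_map ?P (fibre_power X p r) (path_eval r)"
    unfolding fibre_power_def continuous_map_in_subtopology by (simp add: image_subset_iff_funcset)
  moreover have "fibre_power_proj p (path_eval r z) = fst z" if "z \<in> topspace ?P" for z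
    using fib[OF that, of 1] assms by (simp add: fibre_power_proj_def eval)
  ultimately show ?thesis
    unfolding fibrewise_map_def by blast
qed

end

theory Submission
  imports Defs
begin

text \<open>
  Both invariants are least sizes of open covers of the fibred power, so it suffices to show that
  they ask the same of each open set.  This is done for an arbitrary fibrewise map \<open>g\<close> from a
  fibrewise space \<open>W\<close> to the fibred power (\<open>projections_homotopic_iff_path_lift\<close>): the
  coordinates of \<open>g\<close> are pairwise fibrewise homotopic if and only if \<open>g\<close> lifts, up to fibrewise
  homotopy, through the evaluation of fibrewise paths at \<open>r\<close> equidistant times.

  Given a lift, a path can be followed from one evaluation time to another.  So any two
  coordinates of the evaluation map are fibrewise homotopic, and composing with the lift carries
  this over to the coordinates of \<open>g\<close>.  Conversely, homotopies between consecutive coordinates are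
  concatenated to one continuous family of paths parametrised by \<open>W\<close>
  (\<open>concatenated_homotopy\<close>); the path at \<open>w\<close> passes through the coordinates of \<open>g w\<close> at
  the evaluation times, so this lifts \<open>g\<close> on the nose.  Passing between homotopies and maps
  into the path space is the exponential law for the compact-open topology: continuity of the
  curried map is an instance of the tube lemma, and joint continuity of evaluation holds because
  every point of the interval has small compact neighbourhoods.
\<close>

section \<open>The exponential law for the compact-open topology\<close>

text \<open>
  A map sending a compact set \<open>K\<close> into an open set stays that way under a small change of the
  parameter, by the tube lemma.
\<close>

lemma continuous_map_compact_open_curry:
  assumes F: "continuous_map (prod_topology Z W) X (\<lambda>(z, w). F z w)"
  shows "continuous_map W (compact_open_topology Z X) (\<lambda>w. \<lambda>z\<in>topspace Z. F z w)"
    (is "continuous_map W _ ?c")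
proof -
  have cont: "continuous_map Z X (?c w)" if w: "w \<in> topspace W" for w
  proof -
    have "continuous_map Z (prod_topology Z W) (\<lambda>z. (z, w))"
      using w by (intro continuous_intros) auto
    from continuous_map_compose[OF this F] have "continuous_map Z X (\<lambda>z. F z w)"
      by (simp add: o_def)
    then show ?thesis
      by (rule continuous_map_eq) simp
  qed
  let ?N = "\<lambda>K U. {f \<in> extensional (topspace Z). continuous_map Z X f \<and> f ` K \<subseteq> U}"
  have "openin W (?c -` ?N K U \<inter> topspace W)" if K: "compactin Z K" and U: "openin X U" for K U
  proof (subst openin_subopen, intro ballI)
    fix w assume w: "w \<in> ?c -` ?N K U \<inter> topspace W"
    have KZ: "K \<subseteq> topspace Z"
      using K by (simp add: compactin_subset_topspace)
    let ?V = "{y \<in> topspace (prod_topology Z W). (\<lambda>(z, w). F z w) y \<in> U}"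
    have "openin (prod_topology Z W) ?V"
      using F U by (rule openin_continuous_map_preimage)
    moreover have "K \<times> {w} \<subseteq> ?V"
    proof
      fix y assume "y \<in> K \<times> {w}"
      then obtain z where z: "y = (z, w)" "z \<in> K" "z \<in> topspace Z"
        using KZ by auto
      then have "?c w z \<in> U"
        using w by blast
      then show "y \<in> ?V"
        using z w by simp
    qed
    ultimately obtain S T where "openin Z S" "openin W T" "K \<subseteq> S" "w \<in> T" "S \<times> T \<subseteq> ?V"
      using tube_lemma_left[of Z W ?V K w] K w by blast
    moreover have "T \<subseteq> ?c -` ?N K U \<inter> topspace W"
    proof
      fix v assume "v \<in> T"
      then have v: "v \<in> topspace W"
        using \<open>openin W T\<close> openin_subset by blast
      have "F z v \<in> U" if "z \<in> K" for z
      proof -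
        have "(z, v) \<in> ?V"
          using that \<open>v \<in> T\<close> \<open>K \<subseteq> S\<close> \<open>S \<times> T \<subseteq> ?V\<close> by blast
        then show ?thesis
          by simp
      qed
      then show "v \<in> ?c -` ?N K U \<inter> topspace W"
        using v cont[OF v] KZ by auto
    qed
    ultimately show "\<exists>T. openin W T \<and> w \<in> T \<and> T \<subseteq> ?c -` ?N K U \<inter> topspace W"
      by blast
  qed
  moreover have "?c ` topspace W \<subseteq> topspace (compact_open_topology Z X)"
    using cont by (auto simp: topspace_compact_open_topology)
  ultimately show ?thesis
    unfolding compact_open_topology_def continuous_on_generated_topo_iff topology_generated_by_topspace
    by blast
qed

text \<open>
  If \<open>f t\<close> lies in an open set \<open>U\<close>, then \<open>f\<close> maps a compact neighbourhood \<open>K\<close> of \<open>t\<close> into \<open>U\<close>;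
  all maps doing so, taken at points near \<open>t\<close>, have values in \<open>U\<close>.
\<close>

lemma continuous_map_compact_open_joint_eval:
  assumes Z: "neighbourhood_base_of (compactin Z) Z"
  shows "continuous_map (prod_topology (compact_open_topology Z X) Z) X (\<lambda>(f, t). f t)"
proof -
  let ?C = "compact_open_topology Z X"
  let ?N = "\<lambda>K U. {f \<in> extensional (topspace Z). continuous_map Z X f \<and> f ` K \<subseteq> U}"
  let ?P = "\<lambda>U. {y \<in> topspace (prod_topology ?C Z). (\<lambda>(f, t). f t) y \<in> U}"
  have "openin (prod_topology ?C Z) (?P U)" if U: "openin X U" for U
  proof (subst openin_subopen, intro ballI)
    fix y assume "y \<in> ?P U"
    then obtain f t where y: "y = (f, t)" and f: "f \<in> extensional (topspace Z)"
      "continuous_map Z X f" and t: "t \<in> topspace Z" "f t \<in> U"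
      by (auto simp: topspace_compact_open_topology)
    have "openin Z {z \<in> topspace Z. f z \<in> U}"
      using f(2) U by (rule openin_continuous_map_preimage)
    then obtain S K where S: "openin Z S" "compactin Z K" "t \<in> S" "S \<subseteq> K"
      and K: "K \<subseteq> {z \<in> topspace Z. f z \<in> U}"
      using Z t unfolding neighbourhood_base_of by (metis (mono_tags, lifting) mem_Collect_eq)
    have "openin ?C (?N K U)"
      unfolding compact_open_topology_def using S(2) U
      by (intro topology_generated_by_Basis) blast
    then have "openin (prod_topology ?C Z) (?N K U \<times> S)"
      using S(1) by (simp add: openin_prod_Times_iff)
    moreover have "y \<in> ?N K U \<times> S"
      using y f S(3) K by auto
    moreover have "?N K U \<times> S \<subseteq> ?P U"
      using S openin_subset[OF S(1)] by (auto simp: topspace_compact_open_topology)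
    ultimately show "\<exists>T. openin (prod_topology ?C Z) T \<and> y \<in> T \<and> T \<subseteq> ?P U"
      by blast
  qed
  then show ?thesis
    by (auto simp: continuous_map_def topspace_compact_open_topology)
qed

lemma neighbourhood_base_compactin_unit_interval:
  "neighbourhood_base_of (compactin (top_of_set {0..1::real})) (top_of_set {0..1})"
proof -
  have "compact_space (top_of_set {0..1::real})"
    by (simp add: compact_space_subtopology)
  moreover have "Hausdorff_space (top_of_set {0..1::real})"
    by (simp add: Hausdorff_space_subtopology)
  ultimately have "locally_compact_space (top_of_set {0..1::real}) \<and>
      regular_space (top_of_set {0..1::real})"
    by (simp add: compact_imp_locally_compact_space compact_Hausdorff_imp_regular_space)
  then show ?thesis
    unfolding locally_compact_regular_space_neighbourhood_base
    by (rule neighbourhood_base_of_mono) auto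
qed

section \<open>Fibrewise homotopies\<close>

lemma fibrewise_homotopic_sym:
  "fibrewise_homotopic W q Y y f g \<Longrightarrow> fibrewise_homotopic W q Y y g f"
  unfolding fibrewise_homotopic_def by (rule homotopic_with_symD)

lemma fibrewise_homotopic_trans:
  "\<lbrakk>fibrewise_homotopic W q Y y f g; fibrewise_homotopic W q Y y g h\<rbrakk>
   \<Longrightarrow> fibrewise_homotopic W q Y y f h"
  unfolding fibrewise_homotopic_def by (rule homotopic_with_trans)

lemma fibrewise_homotopic_compose_left:
  assumes "fibrewise_homotopic W q Y y f g" and h: "fibrewise_map Y y Z z h"
  shows "fibrewise_homotopic W q Z z (h \<circ> f) (h \<circ> g)"
proof -
  have "homotopic_with (\<lambda>j. continuous_map W Y j \<and> (\<forall>x\<in>topspace W. y (j x) = q x)) W Y f g"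
    using assms(1) unfolding fibrewise_homotopic_def by (rule homotopic_with_mono) simp
  then show ?thesis
    unfolding fibrewise_homotopic_def
    by (rule homotopic_with_compose_continuous_map_left)
      (use h in \<open>auto simp: fibrewise_map_def continuous_map_def Pi_iff\<close>)
qed

lemma fibrewise_homotopic_compose_right:
  assumes "fibrewise_homotopic Y y Z z f g" and h: "fibrewise_map W q Y y h"
  shows "fibrewise_homotopic W q Z z (f \<circ> h) (g \<circ> h)"
  using assms(1) unfolding fibrewise_homotopic_def
  by (rule homotopic_with_compose_continuous_map_right)
    (use h in \<open>auto simp: fibrewise_map_def continuous_map_def Pi_iff\<close>)

text \<open>
  Letting the time parameter range over the whole real line, with the homotopy constant outside
  the unit interval, makes it possible to shift and paste homotopies without tracking domains.
\<close>

lemma fibrewise_homotopy_on_real_line: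
  assumes "fibrewise_homotopic W q X p f g"
  obtains H where "continuous_map (prod_topology euclideanreal W) X H"
    "\<And>t x. t \<le> 0 \<Longrightarrow> H (t, x) = f x" "\<And>t x. t \<ge> 1 \<Longrightarrow> H (t, x) = g x"
    "\<And>t x. x \<in> topspace W \<Longrightarrow> p (H (t, x)) = q x"
proof -
  obtain h where h: "continuous_map (prod_topology (top_of_set {0..1}) W) X h"
      "\<And>x. h (0, x) = f x" "\<And>x. h (1, x) = g x"
      "\<And>t x. \<lbrakk>t \<in> {0..1::real}; x \<in> topspace W\<rbrakk> \<Longrightarrow> p (h (t, x)) = q x"
    using assms unfolding fibrewise_homotopic_def homotopic_with_def by blast
  define c where "c t = max 0 (min 1 t)" for t :: real
  have c: "c t \<in> {0..1}" for t
    by (auto simp: c_def)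
  have "continuous_map euclideanreal euclideanreal c"
    unfolding c_def by (simp add: continuous_intros)
  then have "continuous_map (prod_topology euclideanreal W) (top_of_set {0..1}) (c \<circ> fst)"
    using c by (intro continuous_map_into_subtopology continuous_map_compose[OF continuous_map_fst])
      auto
  then have "continuous_map (prod_topology euclideanreal W) (prod_topology (top_of_set {0..1}) W)
      (\<lambda>z. (c (fst z), snd z))"
    by (intro continuous_map_pairedI continuous_map_snd) (simp add: o_def)
  then have "continuous_map (prod_topology euclideanreal W) X (h \<circ> (\<lambda>z. (c (fst z), snd z)))"
    using h(1) by (rule continuous_map_compose)
  then show ?thesis
    by (rule that) (auto simp: h c, auto simp: c_def h)
qed

text \<open>
  The base case is the constant homotopy at \<open>f 0\<close>.  Each step pastes the next homotopy, shifted
  to start at time \<open>n\<close>, to the previous ones along the slice where \<open>t = n\<close>.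
\<close>

lemma concatenated_homotopy:
  assumes "fibrewise_map W q X p (f 0)"
    and "\<And>i. i < n \<Longrightarrow> fibrewise_homotopic W q X p (f i) (f (Suc i))"
  shows "\<exists>G. continuous_map (prod_topology euclideanreal W) X G \<and>
           (\<forall>i\<le>n. \<forall>x. G (real i, x) = f i x) \<and>
           (\<forall>t. \<forall>x\<in>topspace W. p (G (t, x)) = q x)"
  using assms(2)
proof (induction n)
  case 0
  have "continuous_map (prod_topology euclideanreal W) X (f 0 \<circ> snd)"
    using assms(1) by (auto simp: fibrewise_map_def intro: continuous_map_compose continuous_map_snd)
  then show ?case
    using assms(1) by (intro exI[of _ "f 0 \<circ> snd"]) (auto simp: fibrewise_map_def o_def)
next
  case (Suc n)
  let ?R = "prod_topology euclideanreal W"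
  obtain G where G: "continuous_map ?R X G" "\<And>i x. i \<le> n \<Longrightarrow> G (real i, x) = f i x"
      "\<And>t x. x \<in> topspace W \<Longrightarrow> p (G (t, x)) = q x"
    using Suc.IH Suc.prems by (metis less_SucI)
  obtain H where H: "continuous_map ?R X H" "\<And>t x. t \<le> 0 \<Longrightarrow> H (t, x) = f n x"
      "\<And>t x. t \<ge> 1 \<Longrightarrow> H (t, x) = f (Suc n) x" "\<And>t x. x \<in> topspace W \<Longrightarrow> p (H (t, x)) = q x"
    using fibrewise_homotopy_on_real_line[OF Suc.prems[of n]] by blast
  define G' where "G' z = (if fst z \<le> real n then G z else H (fst z - real n, snd z))" for z
  have "continuous_map ?R ?R (\<lambda>z. (fst z - real n, snd z))"
    by (intro continuous_map_pairedI continuous_map_snd continuous_map_diff continuous_map_fst) simp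
  from continuous_map_compose[OF this H(1)]
  have shift: "continuous_map ?R X (\<lambda>z. H (fst z - real n, snd z))"
    by (simp add: o_def)
  have "continuous_map ?R X G'"
    unfolding G'_def
  proof (rule continuous_map_cases_le)
    show "continuous_map ?R euclideanreal fst"
      by (rule continuous_map_fst)
    show "G z = H (fst z - real n, snd z)" if "fst z = real n" for z
      using that G(2)[of n "snd z"] H(2)[of 0 "snd z"] by (cases z) auto
  qed (auto intro: continuous_map_from_subtopology G(1) shift)
  moreover have "G' (real i, x) = f i x" if "i \<le> Suc n" for i x
    using that G(2)[of i x] H(3)[of 1 x] by (cases "i = Suc n") (auto simp: G'_def)
  moreover have "p (G' (t, x)) = q x" if "x \<in> topspace W" for t x
    using that G(3) H(4) by (simp add: G'_def)
  ultimately show ?case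
    by blast
qed

section \<open>Evaluations of fibrewise paths\<close>

text \<open>The path is followed from time \<open>a\<close> to time \<open>b\<close>, which stays in one fibre.\<close>

lemma fibrewise_homotopic_path_evaluations:
  fixes B :: "'b topology" and X :: "'a topology" and p :: "'a \<Rightarrow> 'b"
  assumes a: "a \<in> {0..1}" and b: "b \<in> {0..1}"
  shows "fibrewise_homotopic (fibrewise_path_space B X p) fst X p (\<lambda>z. snd z a) (\<lambda>z. snd z b)"
proof -
  let ?I = "top_of_set {0..1::real}" and ?P = "fibrewise_path_space B X p"
  define m where "m u = (1 - u) * a + u * b" for u :: real
  have m: "m u \<in> {0..1}" if "u \<in> {0..1}" for u
    using convexD_alt[OF convex_real_interval(5) a b] that by (simp add: m_def)
  have "continuous_map ?I ?I m"
    using m unfolding m_def by (auto intro!: continuous_intros)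
  then have "continuous_map (prod_topology ?I ?P) ?I (m \<circ> fst)"
    by (rule continuous_map_compose[OF continuous_map_fst])
  moreover have "continuous_map ?P (path_space X) snd"
    unfolding fibrewise_path_space_def
    by (intro continuous_map_from_subtopology continuous_map_snd)
  then have "continuous_map (prod_topology ?I ?P) (path_space X) (snd \<circ> snd)"
    by (rule continuous_map_compose[OF continuous_map_snd])
  ultimately have "continuous_map (prod_topology ?I ?P) (prod_topology (path_space X) ?I)
      (\<lambda>y. (snd (snd y), m (fst y)))"
    by (intro continuous_map_pairedI) (simp_all add: o_def)
  from continuous_map_compose[OF this
      continuous_map_compact_open_joint_eval[OF neighbourhood_base_compactin_unit_interval]]
  have "continuous_map (prod_topology ?I ?P) X (\<lambda>(u, z). snd z (m u))"
    by (simp add: o_def case_prod_unfold)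
  moreover have "p (snd z (m u)) = fst z" if "u \<in> {0..1}" "z \<in> topspace ?P" for u z
    using that m by (auto simp: fibrewise_path_space_def)
  ultimately show ?thesis
    unfolding fibrewise_homotopic_def homotopic_with_def
    by (intro exI[of _ "\<lambda>(u, z). snd z (m u)"]) (auto simp: m_def)
qed

lemma fibrewise_map_into_path_space:
  assumes q: "continuous_map W B q"
    and F: "continuous_map (prod_topology (top_of_set {0..1}) W) X (\<lambda>(t, w). F t w)"
    and fib: "\<And>t w. \<lbrakk>t \<in> {0..1}; w \<in> topspace W\<rbrakk> \<Longrightarrow> p (F t w) = q w"
  shows "fibrewise_map W q (fibrewise_path_space B X p) fst (\<lambda>w. (q w, \<lambda>t\<in>{0..1}. F t w))"
proof -
  have "continuous_map W (prod_topology B (path_space X)) (\<lambda>w. (q w, \<lambda>t\<in>{0..1}. F t w))"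
    using continuous_map_compact_open_curry[OF F] by (intro continuous_map_pairedI q) simp
  then show ?thesis
    unfolding fibrewise_map_def fibrewise_path_space_def
    by (auto simp: fib intro!: continuous_map_into_subtopology)
qed

text \<open>
  To build a lift from homotopies, let them join coordinate \<open>i\<close> to coordinate \<open>i + 1\<close>; their
  concatenation over the interval from \<open>0\<close> to \<open>r - 1\<close> is rescaled to unit length, so that the
  integer times become the evaluation times.
\<close>

theorem projections_homotopic_iff_path_lift:
  fixes B :: "'b topology" and X :: "'a topology" and p :: "'a \<Rightarrow> 'b"
  assumes r: "r \<ge> 2" and X: "fibrewise_space B X p"
    and g: "fibrewise_map W q (fibre_power X p r) (fibre_power_proj p) g"
  shows "(\<exists>\<sigma>. fibrewise_map W q (fibrewise_path_space B X p) fst \<sigma> \<and>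
              fibrewise_homotopic W q (fibre_power X p r) (fibre_power_proj p)
                (path_eval r \<circ> \<sigma>) g) \<longleftrightarrow>
         (\<forall>s\<in>{1..r}. \<forall>t\<in>{1..r}. fibrewise_homotopic W q X p (pr s \<circ> g) (pr t \<circ> g))"
    (is "(\<exists>\<sigma>. ?lift \<sigma>) \<longleftrightarrow> ?hom")
proof
  assume "\<exists>\<sigma>. ?lift \<sigma>"
  then obtain \<sigma> where \<sigma>: "fibrewise_map W q (fibrewise_path_space B X p) fst \<sigma>"
    and lift: "fibrewise_homotopic W q (fibre_power X p r) (fibre_power_proj p)
                 (path_eval r \<circ> \<sigma>) g"
    by blast
  define \<tau> where "\<tau> i = (real i - 1) / (real r - 1)" for i
  have \<tau>: "\<tau> i \<in> {0..1}" if "i \<in> {1..r}" for i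
    using that r by (auto simp: \<tau>_def divide_simps)
  have eval: "pr i \<circ> (path_eval r \<circ> \<sigma>) = (\<lambda>z. snd z (\<tau> i)) \<circ> \<sigma>" if "i \<in> {1..r}" for i
    using that by (simp add: fun_eq_iff pr_def path_eval_def \<tau>_def case_prod_beta)
  have coord: "fibrewise_homotopic W q X p ((\<lambda>z. snd z (\<tau> i)) \<circ> \<sigma>) (pr i \<circ> g)"
    if "i \<in> {1..r}" for i
    using fibrewise_homotopic_compose_left[OF lift fibrewise_map_pr[OF that]]
    by (simp only: eval[OF that])
  show ?hom
  proof (intro ballI)
    fix s t assume s: "s \<in> {1..r}" and t: "t \<in> {1..r}"
    have "fibrewise_homotopic W q X p ((\<lambda>z. snd z (\<tau> s)) \<circ> \<sigma>) ((\<lambda>z. snd z (\<tau> t)) \<circ> \<sigma>)"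
      using fibrewise_homotopic_path_evaluations[OF \<tau>[OF s] \<tau>[OF t]] \<sigma>
      by (rule fibrewise_homotopic_compose_right)
    then show "fibrewise_homotopic W q X p (pr s \<circ> g) (pr t \<circ> g)"
      using coord[OF s] coord[OF t] fibrewise_homotopic_sym fibrewise_homotopic_trans by metis
  qed
next
  assume hom: ?hom
  have g_cont: "continuous_map W (fibre_power X p r) g"
    and g_fib: "\<And>x. x \<in> topspace W \<Longrightarrow> p (g x 1) = q x"
    using g by (auto simp: fibrewise_map_def fibre_power_proj_def)
  have g_first: "fibrewise_map W q X p (pr 1 \<circ> g)"
    using continuous_map_compose[OF g_cont, of X "pr 1"] fibrewise_map_pr[of 1 r X p] r g_fib
    by (simp add: fibrewise_map_def pr_def)
  have "\<exists>G. continuous_map (prod_topology euclideanreal W) X G \<and>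
      (\<forall>i\<le>r - 1. \<forall>x. G (real i, x) = (pr (Suc i) \<circ> g) x) \<and>
      (\<forall>t. \<forall>x\<in>topspace W. p (G (t, x)) = q x)"
    by (rule concatenated_homotopy[where f = "\<lambda>i. pr (Suc i) \<circ> g"]) (use g_first hom in auto)
  then obtain G where G: "continuous_map (prod_topology euclideanreal W) X G"
      "\<And>i x. i \<le> r - 1 \<Longrightarrow> G (real i, x) = g x (Suc i)"
      "\<And>t x. x \<in> topspace W \<Longrightarrow> p (G (t, x)) = q x"
    by (auto simp: pr_def)
  define F where "F t x = G (t * (real r - 1), x)" for t x
  define \<sigma> where "\<sigma> x = (q x, \<lambda>t\<in>{0..1}. F t x)" for x
  have "continuous_map W X (pr 1 \<circ> g)"
    using g_first by (simp add: fibrewise_map_def)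
  from continuous_map_compose[OF this X[unfolded fibrewise_space_def]]
  have q: "continuous_map W B q"
    by (rule continuous_map_eq) (use g_fib in \<open>simp add: pr_def\<close>)
  have "continuous_map (prod_topology (top_of_set {0..1}) W) (prod_topology euclideanreal W)
      (\<lambda>y. (fst y * (real r - 1), snd y))"
    by (intro continuous_map_pairedI continuous_map_snd continuous_map_real_mult
        continuous_map_fst[THEN continuous_map_into_fulltopology]) simp
  from continuous_map_compose[OF this G(1)]
  have "continuous_map (prod_topology (top_of_set {0..1}) W) X (\<lambda>(t, x). F t x)"
    by (simp add: F_def o_def case_prod_unfold)
  then have "fibrewise_map W q (fibrewise_path_space B X p) fst \<sigma>"
    unfolding \<sigma>_def using q G(3) by (intro fibrewise_map_into_path_space) (auto simp: F_def)
  moreover have "(path_eval r \<circ> \<sigma>) x = g x" if x: "x \<in> topspace W" for x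
  proof
    fix i
    have "g x \<in> extensional {1..r}"
      using g_cont x by (auto simp: fibre_power_def continuous_map_def PiE_def)
    moreover have "F ((real i - 1) / (real r - 1)) x = g x i"
      and "(real i - 1) / (real r - 1) \<in> {0..1}" if "i \<in> {1..r}"
      using that r G(2)[of "i - 1" x] by (auto simp: F_def divide_simps of_nat_diff)
    ultimately show "(path_eval r \<circ> \<sigma>) x i = g x i"
      by (auto simp: path_eval_def \<sigma>_def extensional_def)
  qed
  then have "fibrewise_homotopic W q (fibre_power X p r) (fibre_power_proj p)
      (path_eval r \<circ> \<sigma>) g"
    unfolding fibrewise_homotopic_def using g
    by (intro homotopic_with_symD[OF homotopic_with_equal]) (auto simp: fibrewise_map_def)
  ultimately show "\<exists>\<sigma>. ?lift \<sigma>"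
    by blast
qed

text \<open>
  The criterion for the inclusion of a subset \<open>V\<close> of the fibred power says that the covers counted
  on the two sides are the same.
\<close>

theorem corollary4p4:
  fixes B :: "'b topology" and X :: "'a topology" and p :: "'a \<Rightarrow> 'b" and r :: nat
  assumes "r \<ge> 2" and "fibrewise_space B X p"
  shows "fibrewise_dist (fibre_power X p r) (fibre_power_proj p) X p r pr =
           fibrewise_secat (fibrewise_path_space B X p) fst
             (fibre_power X p r) (fibre_power_proj p) (path_eval r) \<and>
         fibrewise_secat (fibrewise_path_space B X p) fst
             (fibre_power X p r) (fibre_power_proj p) (path_eval r) =
           fibrewise_TC B X p r"
proof -
  have "(\<exists>\<sigma>. fibrewise_map (subtopology (fibre_power X p r) V) (fibre_power_proj p)
               (fibrewise_path_space B X p) fst \<sigma> \<and>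
             fibrewise_homotopic (subtopology (fibre_power X p r) V) (fibre_power_proj p)
               (fibre_power X p r) (fibre_power_proj p) (path_eval r \<circ> \<sigma>) (\<lambda>x. x)) \<longleftrightarrow>
        (\<forall>s\<in>{1..r}. \<forall>t\<in>{1..r}.
           fibrewise_homotopic (subtopology (fibre_power X p r) V) (fibre_power_proj p) X p
             (pr s) (pr t))" for V
  proof -
    have "fibrewise_map (subtopology (fibre_power X p r) V) (fibre_power_proj p)
            (fibre_power X p r) (fibre_power_proj p) (\<lambda>x. x)"
      by (simp add: fibrewise_map_def continuous_map_from_subtopology)
    from projections_homotopic_iff_path_lift[OF assms this] show ?thesis
      by (simp add: o_def)
  qed
  then show ?thesis
    unfolding fibrewise_dist_def fibrewise_secat_def fibrewise_TC_def by simp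
qed

end
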